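(* Let $X=(X_t)_{t\in[0,T]}$ be a Gaussian process satisfying the standing assumption (A) of the context, let $\Delta$ be a finite union of intervals as in the context, let $\Delta_N=\{t_1,\dots,t_N\}\subset\Delta$ be a set of $N$ points, and suppose that the covariance matrix $\mathbf{R}_N=(\mathbb{E}[X_{t_i}X_{t_j}])_{i,j=1}^N$ has full rank. For $t\in[0,T]$ let $\mathbf{b}_N(t)=(\mathbb{E}[X_tX_{t_j}])_{j=1}^N\in\mathbb{R}^N$. Then for any $t\in[0,T]\setminus\Delta_N$, $$\hat X_{t,N}=\mathbb{E}[X_t\mid\mathcal{F}_{\Delta_N}]=\sum_{t_j\in\Delta_N}a_j(t)X_{t_j},$$ where $\mathbf{a}(t)=(a_1(t),\dots,a_N(t))^T=\mathbf{R}_N^{-1}\mathbf{b}_N(t)$. Moreover, if the sequence $(\mathcal{F}_{\Delta_N})_{N\ge1}$ increases to $\mathcal{F}_\Delta$, then $\hat X_{t,N}\to\mathbb{E}[X_t\mid\mathcal{F}_\Delta]$ in $L^2(\Omega)$ as $N\to\infty$.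
   Context: Standing assumption (A): $T>0$; $X=(X_t)_{t\in[0,T]}$ is a centered and separable Gaussian process on a probability space $(\Omega,\mathcal{F},\mathbb{P})$ with $\sup_{t\in[0,T]}\mathbb{E}[X_t^2]<\infty$; there exist a deterministic kernel $K\in L^2([0,T]^2)$ and a standard Brownian motion $W$ such that $X_t=\int_0^T K(t,s)\,dW_s$ holds exactly (almost surely) for every $t\in[0,T]$, where the integral is a Wiener integral (so $K(t,\cdot)\in L^2([0,T])$ for every $t$); and $H^X_T=H^W_T$. Here, for a process $Z$, $H^Z_t$ denotes the closure in $L^2(\Omega)$ of the linear span of $\{Z_s:s\in[0,t]\}$. Consequently $\mathbb{E}[X_tX_s]=\int_0^TK(t,u)K(s,u)\,du$. The set $\Delta$ is of the form $\Delta=[t_L^1,t_U^1]\cup\dots\cup[t_L^n,t_U^n]$ with $0\le t_L^1<t_U^1<t_L^2<\dots<t_L^n<t_U^n\le T$. For a set $D\subset[0,T]$, $\mathcal{F}_D=\sigma(X_t:t\in D)$. "$\mathcal{F}_{\Delta_N}$ increases to $\mathcal{F}_\Delta$" means $\mathcal{F}_{\Delta_N}\subset\mathcal{F}_{\Delta_{N+1}}$ for all $N$ and $\bigcup_N\mathcal{F}_{\Delta_N}$ generates $\mathcal{F}_\Delta$. *)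

theory Defs
  imports
    "HOL-Probability.Probability"
    "Jordan_Normal_Form.DL_Rank"
    "Jordan_Normal_Form.Gauss_Jordan_Elimination"
begin

section \<open>Square-integrable functions\<close>

text \<open>Elements of $L^2$ are represented by functions; nothing is quotiented by a.e. equality.\<close>

definition square_integrable :: "'a measure \<Rightarrow> ('a \<Rightarrow> real) \<Rightarrow> bool" where
  "square_integrable M f \<longleftrightarrow> f \<in> borel_measurable M \<and> integrable M (\<lambda>x. (f x)\<^sup>2)"

definition L2_tendsto :: "'a measure \<Rightarrow> (nat \<Rightarrow> 'a \<Rightarrow> real) \<Rightarrow> ('a \<Rightarrow> real) \<Rightarrow> bool" where
  "L2_tendsto M f g \<longleftrightarrow> (\<forall>n. square_integrable M (f n)) \<and> square_integrable M g \<and>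
     (\<lambda>n. \<integral>x. (f n x - g x)\<^sup>2 \<partial>M) \<longlonglongrightarrow> 0"

section \<open>Gaussian processes\<close>

text \<open>Degenerate (a.s. constant) variables count as Gaussian; they have no density, hence the
  separate disjunct.\<close>

definition gaussian_rv :: "'a measure \<Rightarrow> ('a \<Rightarrow> real) \<Rightarrow> bool" where
  "gaussian_rv M Y \<longleftrightarrow> Y \<in> borel_measurable M \<and>
     ((\<exists>\<mu> \<sigma>. \<sigma> > 0 \<and> distributed M lborel Y (\<lambda>x. ennreal (normal_density \<mu> \<sigma> x))) \<or>
      (\<exists>c. AE \<omega> in M. Y \<omega> = c))"

definition gaussian_process :: "'a measure \<Rightarrow> 'i set \<Rightarrow> ('i \<Rightarrow> 'a \<Rightarrow> real) \<Rightarrow> bool" where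
  "gaussian_process M I X \<longleftrightarrow>
     (\<forall>F c. finite F \<and> F \<subseteq> I \<longrightarrow> gaussian_rv M (\<lambda>\<omega>. \<Sum>t\<in>F. c t * X t \<omega>))"

definition centered_process :: "'a measure \<Rightarrow> 'i set \<Rightarrow> ('i \<Rightarrow> 'a \<Rightarrow> real) \<Rightarrow> bool" where
  "centered_process M I X \<longleftrightarrow> (\<forall>t\<in>I. integrable M (X t) \<and> (\<integral>\<omega>. X t \<omega> \<partial>M) = 0)"

text \<open>Separability in the sense of Doob. Density of the separant \<open>S\<close> in \<open>I\<close> need not be required
  separately: on a space of positive measure it follows by taking \<open>C = {}\<close>.\<close>

definition separable_process :: "'a measure \<Rightarrow> real set \<Rightarrow> (real \<Rightarrow> 'a \<Rightarrow> real) \<Rightarrow> bool" where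
  "separable_process M I X \<longleftrightarrow>
     (\<exists>S N. countable S \<and> S \<subseteq> I \<and> N \<in> null_sets M \<and>
        (\<forall>a b C. closed C \<longrightarrow>
           {\<omega> \<in> space M. \<forall>s \<in> S \<inter> {a<..<b}. X s \<omega> \<in> C} -
           {\<omega> \<in> space M. \<forall>t \<in> I \<inter> {a<..<b}. X t \<omega> \<in> C} \<subseteq> N))"

section \<open>Brownian motion and the Wiener integral\<close>

definition brownian_motion :: "'a measure \<Rightarrow> real \<Rightarrow> (real \<Rightarrow> 'a \<Rightarrow> real) \<Rightarrow> bool" where
  "brownian_motion M T W \<longleftrightarrow>
     (\<forall>t\<in>{0..T}. W t \<in> borel_measurable M) \<and>
     (AE \<omega> in M. W 0 \<omega> = 0) \<and>
     (\<forall>s t. 0 \<le> s \<and> s < t \<and> t \<le> T \<longrightarrow>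
        distributed M lborel (\<lambda>\<omega>. W t \<omega> - W s \<omega>)
          (\<lambda>x. ennreal (normal_density 0 (sqrt (t - s)) x))) \<and>
     (\<forall>(n::nat) p. strict_mono_on {..n} p \<and> p ` {..n} \<subseteq> {0..T} \<longrightarrow>
        prob_space.indep_vars M (\<lambda>_. borel) (\<lambda>i \<omega>. W (p (Suc i)) \<omega> - W (p i) \<omega>) {..<n}) \<and>
     (AE \<omega> in M. continuous_on {0..T} (\<lambda>t. W t \<omega>))"

text \<open>The step function $\sum_{i<n} c_i 1_{(p_i,p_{i+1}]}$ and its elementary integral.\<close>

definition step_fun :: "nat \<Rightarrow> (nat \<Rightarrow> real) \<Rightarrow> (nat \<Rightarrow> real) \<Rightarrow> real \<Rightarrow> real" where
  "step_fun n c p s = (\<Sum>i<n. c i * indicator {p i<..p (Suc i)} s)"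

definition step_integral ::
    "(real \<Rightarrow> 'a \<Rightarrow> real) \<Rightarrow> nat \<Rightarrow> (nat \<Rightarrow> real) \<Rightarrow> (nat \<Rightarrow> real) \<Rightarrow> 'a \<Rightarrow> real" where
  "step_integral W n c p \<omega> = (\<Sum>i<n. c i * (W (p (Suc i)) \<omega> - W (p i) \<omega>))"

text \<open>\<open>has_wiener_integral M T W f Y\<close> says that \<open>Y\<close> is (a version of) $\int_0^T f(s)\,dW_s$: the
  $L^2$-limit of the elementary integrals of step functions converging to \<open>f\<close> in
  $L^2([0,T])$. For Brownian \<open>W\<close> the It\^o isometry makes \<open>Y\<close> unique up to a.s. equality and
  independent of the approximating sequence.\<close>

definition has_wiener_integral ::
    "'a measure \<Rightarrow> real \<Rightarrow> (real \<Rightarrow> 'a \<Rightarrow> real) \<Rightarrow> (real \<Rightarrow> real) \<Rightarrow> ('a \<Rightarrow> real) \<Rightarrow> bool" where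
  "has_wiener_integral M T W f Y \<longleftrightarrow>
     (\<exists>n c p. (\<forall>k. mono_on {..n k} (p k) \<and> p k ` {..n k} \<subseteq> {0..T}) \<and>
        L2_tendsto (lebesgue_on {0..T}) (\<lambda>k. step_fun (n k) (c k) (p k)) f \<and>
        L2_tendsto M (\<lambda>k. step_integral W (n k) (c k) (p k)) Y)"

text \<open>The closed linear span of $\{Z_s : s \in I\}$ in $L^2(\Omega)$, as the set of all
  representatives of its elements; it is closed under a.s. equality of random variables, so
  equality of such sets is equality of the subspaces.\<close>

definition closed_lin_span :: "'a measure \<Rightarrow> 'i set \<Rightarrow> ('i \<Rightarrow> 'a \<Rightarrow> real) \<Rightarrow> ('a \<Rightarrow> real) set" where
  "closed_lin_span M I Z =
     {Y. \<exists>F c. (\<forall>k. finite (F k) \<and> F k \<subseteq> I) \<and>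
           L2_tendsto M (\<lambda>k \<omega>. \<Sum>s\<in>F k. c k s * Z s \<omega>) Y}"

section \<open>The standing assumption\<close>

definition standing_assumption :: "'a measure \<Rightarrow> real \<Rightarrow> (real \<Rightarrow> 'a \<Rightarrow> real) \<Rightarrow> bool" where
  "standing_assumption M T X \<longleftrightarrow>
     T > 0 \<and> prob_space M \<and>
     gaussian_process M {0..T} X \<and> centered_process M {0..T} X \<and> separable_process M {0..T} X \<and>
     bdd_above ((\<lambda>t. \<integral>\<omega>. (X t \<omega>)\<^sup>2 \<partial>M) ` {0..T}) \<and>
     (\<exists>K W. square_integrable (lebesgue_on ({0..T} \<times> {0..T})) (\<lambda>(t, s). K t s) \<and>
        (\<forall>t\<in>{0..T}. square_integrable (lebesgue_on {0..T}) (K t)) \<and>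
        brownian_motion M T W \<and>
        (\<forall>t\<in>{0..T}. has_wiener_integral M T W (K t) (X t)) \<and>
        closed_lin_span M {0..T} X = closed_lin_span M {0..T} W)"

section \<open>Observation sets and generated sigma-algebras\<close>

definition interval_union :: "real \<Rightarrow> real set \<Rightarrow> bool" where
  "interval_union T \<Delta> \<longleftrightarrow>
     (\<exists>(n::nat) tL tU. n \<ge> 1 \<and> 0 \<le> tL 1 \<and> tU n \<le> T \<and>
        (\<forall>i\<in>{1..n}. tL i < tU i) \<and> (\<forall>i\<in>{1..<n}. tU i < tL (Suc i)) \<and>
        \<Delta> = (\<Union>i\<in>{1..n}. {tL i..tU i}))"

definition sigma_gen :: "'a measure \<Rightarrow> ('i \<Rightarrow> 'a \<Rightarrow> real) \<Rightarrow> 'i set \<Rightarrow> 'a measure" where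
  "sigma_gen M X D = sigma (space M) {X t -` A \<inter> space M | t A. t \<in> D \<and> A \<in> sets borel}"

definition sigma_increases_to :: "(nat \<Rightarrow> 'a measure) \<Rightarrow> 'a measure \<Rightarrow> bool" where
  "sigma_increases_to G H \<longleftrightarrow>
     (\<forall>N\<ge>1. sets (G N) \<subseteq> sets (G (Suc N))) \<and>
     sets H = sigma_sets (space H) (\<Union>N\<in>{1..}. sets (G N))"

section \<open>Covariance matrices\<close>

text \<open>The \<open>N\<close> points $t_1,\dots,t_N$ are \<open>p 0, \<dots>, p (N - 1)\<close>, following the zero-based
  indexing of matrices.\<close>

definition cov_mat :: "'a measure \<Rightarrow> ('i \<Rightarrow> 'a \<Rightarrow> real) \<Rightarrow> nat \<Rightarrow> (nat \<Rightarrow> 'i) \<Rightarrow> real mat" where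
  "cov_mat M X N p = mat N N (\<lambda>(i, j). \<integral>\<omega>. X (p i) \<omega> * X (p j) \<omega> \<partial>M)"

definition cov_vec :: "'a measure \<Rightarrow> ('i \<Rightarrow> 'a \<Rightarrow> real) \<Rightarrow> nat \<Rightarrow> (nat \<Rightarrow> 'i) \<Rightarrow> 'i \<Rightarrow> real vec" where
  "cov_vec M X N p t = vec N (\<lambda>j. \<integral>\<omega>. X t \<omega> * X (p j) \<omega> \<partial>M)"

text \<open>$\mathbf{R}_N^{-1}\mathbf{b}_N(t)$; \<open>mat_inverse\<close> is \<open>None\<close> on singular matrices, so this is
  meaningful only if the covariance matrix is invertible.\<close>

definition pred_coeffs :: "'a measure \<Rightarrow> ('i \<Rightarrow> 'a \<Rightarrow> real) \<Rightarrow> nat \<Rightarrow> (nat \<Rightarrow> 'i) \<Rightarrow> 'i \<Rightarrow> real vec" where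
  "pred_coeffs M X N p t = the (mat_inverse (cov_mat M X N p)) *\<^sub>v cov_vec M X N p t"

definition full_rank_points ::
    "'a measure \<Rightarrow> ('i \<Rightarrow> 'a \<Rightarrow> real) \<Rightarrow> 'i set \<Rightarrow> nat \<Rightarrow> (nat \<Rightarrow> 'i) \<Rightarrow> bool" where
  "full_rank_points M X \<Delta> N p \<longleftrightarrow>
     inj_on p {..<N} \<and> p ` {..<N} \<subseteq> \<Delta> \<and> vec_space.rank N (cov_mat M X N p) = N"

end

theory Submission
  imports Defs
begin

text \<open>The normal equations $\mathbf{R}_N\mathbf{a}(t)=\mathbf{b}_N(t)$ make the residual
  $Y = X_t-\sum_j a_j(t)X_{t_j}$ uncorrelated with every $X_{t_j}$. For jointly Gaussian variables the
  Fourier transform of the complex weight $e^{isY}-\mathbb{E}[e^{isY}]$ along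
  $(X_{t_1},\dots,X_{t_N})$ then vanishes, so by L\'evy's one-dimensional uniqueness theorem, applied
  one coordinate at a time, and Dynkin's lemma the weight integrates to zero over every set of
  $\mathcal{F}_{\Delta_N}$. Hence $Y$ is independent of $\mathcal{F}_{\Delta_N}$ and the residual has
  conditional expectation zero. The convergence is L\'evy's upward theorem in $L^2$: square-integrable
  functions measurable for some $\mathcal{F}_{\Delta_N}$ are dense among those measurable for
  $\mathcal{F}_\Delta$, and conditional expectations are $L^2$ contractions.\<close>

section \<open>Weights with vanishing Fourier transform\<close>

text \<open>A nonnegative weight of total mass one is a probability density, so the law of
  \<open>X\<close> under the weighted measure is open to \<open>Levy_uniqueness\<close>. The
  transfer formula is kept for general Banach-valued \<open>f\<close> because it serves both complex
  exponentials and real test functions.\<close>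

lemma distr_weight:
  fixes X p :: "'a \<Rightarrow> real"
  assumes p: "integrable M p" "\<And>x. 0 \<le> p x" "(\<integral>x. p x \<partial>M) = 1"
    and X[measurable]: "X \<in> borel_measurable M"
  shows "real_distribution (distr (density M p) borel X)"
    and "\<And>f :: real \<Rightarrow> 'b :: {banach, second_countable_topology}. f \<in> borel_measurable borel \<Longrightarrow>
      (\<integral>y. f y \<partial>distr (density M p) borel X) = (\<integral>x. p x *\<^sub>R f (X x) \<partial>M)"
proof -
  have [measurable]: "p \<in> borel_measurable M" using p(1) by simp
  have "prob_space (density M p)"
    by (rule prob_spaceI) (simp add: emeasure_density nn_integral_eq_integral p cong: nn_integral_cong)
  then interpret prob_space "density M p" .
  show "real_distribution (distr (density M p) borel X)" by simp
  show "(\<integral>y. f y \<partial>distr (density M p) borel X) = (\<integral>x. p x *\<^sub>R f (X x) \<partial>M)"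
    if "f \<in> borel_measurable borel" for f :: "real \<Rightarrow> 'b"
    using that p(2) by (simp add: integral_distr integral_density)
qed

text \<open>The positive and negative parts of \<open>H\<close> have equal mass; after normalisation
  the hypothesis says that the laws of \<open>X\<close> under them share their characteristic
  function, so these laws coincide. Integrability of \<open>H x * f (X x)\<close> replaces
  boundedness of \<open>f\<close>, which later admits the identity as \<open>f\<close>.\<close>

lemma fourier_zero_imp_integral_zero_real:
  fixes H X :: "'a \<Rightarrow> real" and f :: "real \<Rightarrow> real"
  assumes H: "integrable M H" and X[measurable]: "X \<in> borel_measurable M"
    and zero: "\<And>c. (\<integral>x. H x *\<^sub>R iexp (c * X x) \<partial>M) = 0"
    and f[measurable]: "f \<in> borel_measurable borel"
    and Hf: "integrable M (\<lambda>x. H x * f (X x))"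
  shows "(\<integral>x. H x * f (X x) \<partial>M) = 0"
proof -
  have [measurable]: "H \<in> borel_measurable M" using H by simp
  define P N where "P = (\<lambda>x. max 0 (H x))" and "N = (\<lambda>x. max 0 (- H x))"
  have HPN: "H x = P x - N x" for x by (simp add: P_def N_def)
  have P: "integrable M P" and N: "integrable M N"
    using H by (auto simp: P_def N_def intro!: integrable_max)
  have pos: "0 \<le> P x" "0 \<le> N x" for x by (auto simp: P_def N_def)
  define m where "m = (\<integral>x. P x \<partial>M)"
  \<comment> \<open>Frequency zero: the total integral of \<open>H\<close> vanishes, so both parts
    have the same mass \<open>m\<close>.\<close>
  have "complex_of_real (\<integral>x. H x \<partial>M) = 0"
    using zero[of 0] by (simp add: scaleR_conv_of_real)
  then have mN: "(\<integral>x. N x \<partial>M) = m" using P N by (simp add: HPN m_def)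
  show ?thesis
  proof (cases "m = 0")
    \<comment> \<open>Without mass nothing can be normalised, but then \<open>H\<close> is zero
      almost everywhere.\<close>
    case True
    have "AE x in M. P x = 0" "AE x in M. N x = 0"
      using True mN pos integral_nonneg_eq_0_iff_AE[OF P] integral_nonneg_eq_0_iff_AE[OF N]
      by (auto simp: m_def)
    then have "AE x in M. H x * f (X x) = 0" by eventually_elim (simp add: HPN)
    then show ?thesis by (rule integral_eq_zero_AE)
  next
    case False
    have "0 \<le> m" unfolding m_def using pos by simp
    with False have m: "0 < m" by simp
    let ?P = "\<lambda>x. P x / m" and ?N = "\<lambda>x. N x / m"
    have P': "integrable M ?P" "\<And>x. 0 \<le> ?P x" "(\<integral>x. ?P x \<partial>M) = 1"
      using P pos m by (auto simp: m_def)
    have N': "integrable M ?N" "\<And>x. 0 \<le> ?N x" "(\<integral>x. ?N x \<partial>M) = 1"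
      using N pos m by (auto simp: mN)
    note dP = distr_weight[OF P' X] and dN = distr_weight[OF N' X]
    have int: "integrable M (\<lambda>x. P x *\<^sub>R iexp (t * X x))" "integrable M (\<lambda>x. N x *\<^sub>R iexp (t * X x))" for t
      by (rule Bochner_Integration.integrable_bound[OF P] Bochner_Integration.integrable_bound[OF N],
          use pos P N in \<open>auto\<close>)+
    have eq: "(\<integral>x. P x *\<^sub>R iexp (t * X x) \<partial>M) = (\<integral>x. N x *\<^sub>R iexp (t * X x) \<partial>M)" for t
      using zero[of t] int[of t] by (simp add: HPN scaleR_diff_left del: scaleR_conv_of_real)
    have "(\<integral>x. ?P x *\<^sub>R iexp (t * X x) \<partial>M) = (\<integral>x. (1/m) *\<^sub>R (P x *\<^sub>R iexp (t * X x)) \<partial>M)" for t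
      by simp
    then have e1: "(\<integral>x. ?P x *\<^sub>R iexp (t * X x) \<partial>M) = (1/m) *\<^sub>R (\<integral>x. P x *\<^sub>R iexp (t * X x) \<partial>M)" for t
      by (simp only: integral_scaleR_right)
    have "(\<integral>x. ?N x *\<^sub>R iexp (t * X x) \<partial>M) = (\<integral>x. (1/m) *\<^sub>R (N x *\<^sub>R iexp (t * X x)) \<partial>M)" for t
      by simp
    then have e2: "(\<integral>x. ?N x *\<^sub>R iexp (t * X x) \<partial>M) = (1/m) *\<^sub>R (\<integral>x. N x *\<^sub>R iexp (t * X x) \<partial>M)" for t
      by (simp only: integral_scaleR_right)
    have "char (distr (density M ?P) borel X) = char (distr (density M ?N) borel X)"
      unfolding char_def by (rule ext) (subst dP(2) dN(2), simp, subst dP(2) dN(2), simp, unfold e1 e2 eq, rule refl)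
    then have "distr (density M ?P) borel X = distr (density M ?N) borel X"
      by (rule Levy_uniqueness[OF dP(1) dN(1)])
    then have "(\<integral>x. ?P x *\<^sub>R f (X x) \<partial>M) = (\<integral>x. ?N x *\<^sub>R f (X x) \<partial>M)"
      by (simp only: dP(2)[OF f, symmetric] dN(2)[OF f, symmetric])
    then have eqf: "(\<integral>x. P x * f (X x) \<partial>M) = (\<integral>x. N x * f (X x) \<partial>M)"
      using m by simp
    have [measurable]: "P \<in> borel_measurable M" "N \<in> borel_measurable M" using P N by auto
    \<comment> \<open>Both products are dominated by \<open>H x * f (X x)\<close> in absolute value,
      so the integral of the difference may be split.\<close>
    have "integrable M (\<lambda>x. P x * f (X x))" "integrable M (\<lambda>x. N x * f (X x))"
      by (rule Bochner_Integration.integrable_bound[OF Hf]; auto simp: P_def N_def abs_mult mult_right_mono)+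
    then show ?thesis using eqf by (simp add: HPN left_diff_distrib)
  qed
qed

text \<open>The real case applies to \<open>Re H\<close> and \<open>Im H\<close> separately, since
  their transforms are combinations of those of \<open>H\<close> and its conjugate. Indicators keep
  every integrand dominated by \<open>H\<close>.\<close>

lemma fourier_zero_imp_integral_indicator_zero:
  fixes H :: "'a \<Rightarrow> complex" and X :: "'a \<Rightarrow> real"
  assumes H: "integrable M H" and X[measurable]: "X \<in> borel_measurable M"
    and zero: "\<And>c. (\<integral>x. H x * iexp (c * X x) \<partial>M) = 0"
    and B[measurable]: "B \<in> sets borel"
  shows "(\<integral>x. H x * indicator B (X x) \<partial>M) = 0"
proof -
  have [measurable]: "H \<in> borel_measurable M" using H by simp
  have int: "integrable M (\<lambda>x. H x * iexp (c * X x))" for c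
    by (rule Bochner_Integration.integrable_bound[OF H]) (auto simp: norm_mult)
  have intB: "integrable M (\<lambda>x. H x * indicator B (X x))"
    by (rule Bochner_Integration.integrable_bound[OF H]) (auto simp: norm_mult indicator_def)
  \<comment> \<open>Conjugation flips the sign of \<open>c\<close>, so the transforms of \<open>Re H\<close> and \<open>Im H\<close> vanish too.\<close>
  have cnj: "(\<integral>x. cnj (H x) * iexp (c * X x) \<partial>M) = 0" for c
  proof -
    have "(\<integral>x. cnj (H x) * iexp (c * X x) \<partial>M) = (\<integral>x. cnj (H x * iexp ((- c) * X x)) \<partial>M)"
      by (simp add: exp_cnj)
    also have "\<dots> = cnj (\<integral>x. H x * iexp ((- c) * X x) \<partial>M)" by (rule Bochner_Integration.integral_cnj)
    finally show ?thesis unfolding zero by simp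
  qed
  have [measurable]: "(\<lambda>x. cnj (H x)) \<in> borel_measurable M"
    using H by (intro borel_measurable_integrable) simp
  have intc: "integrable M (\<lambda>x. cnj (H x) * iexp (c * X x))" for c
    by (rule Bochner_Integration.integrable_bound[OF H]) (auto simp: norm_mult)
  have Re: "Re z *\<^sub>R w = (1/2) * (z * w + cnj z * w)" and Im: "Im z *\<^sub>R w = (- \<i>/2) * (z * w - cnj z * w)" for z w
    by (simp_all add: complex_eq_iff field_simps)
  have ReB: "Re (z * indicator B y) = Re z * indicator B y"
    and ImB: "Im (z * indicator B y) = Im z * indicator B y" for z and y :: real
    by (auto simp: indicator_def)
  have "(\<integral>x. Re (H x) *\<^sub>R iexp (c * X x) \<partial>M) = 0" for c
    unfolding Re using zero[of c] cnj[of c] int[of c] intc[of c]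
    by (subst integral_mult_right_zero, subst Bochner_Integration.integral_add) auto
  then have "(\<integral>x. Re (H x) * indicator B (X x) \<partial>M) = 0"
    using H integrable_Re[OF intB] unfolding ReB ImB
    by (intro fourier_zero_imp_integral_zero_real[of M _ X]) auto
  moreover have "(\<integral>x. Im (H x) *\<^sub>R iexp (c * X x) \<partial>M) = 0" for c
    unfolding Im using zero[of c] cnj[of c] int[of c] intc[of c]
    by (subst integral_mult_right_zero, subst Bochner_Integration.integral_diff) auto
  then have "(\<integral>x. Im (H x) * indicator B (X x) \<partial>M) = 0"
    using H integrable_Im[OF intB] unfolding ReB ImB
    by (intro fourier_zero_imp_integral_zero_real[of M _ X]) auto
  ultimately show ?thesis
    using integral_Re[OF intB] integral_Im[OF intB] unfolding ReB ImB by (simp add: complex_eq_iff)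
qed


text \<open>Induction over the coordinates reduces the multidimensional statement to the
  one-dimensional one. The weight must be arbitrary in the induction, because the exponential in the
  new coordinate \<open>k\<close> is absorbed into it.\<close>

lemma fourier_zero_imp_rectangle_zero:
  fixes H :: "'a \<Rightarrow> complex" and X :: "'i \<Rightarrow> 'a \<Rightarrow> real"
  assumes S: "finite S" and X: "\<And>j. j \<in> S \<Longrightarrow> X j \<in> borel_measurable M"
    and B: "\<And>j. j \<in> S \<Longrightarrow> B j \<in> sets borel"
    and H: "integrable M H"
    and zero: "\<And>c. (\<integral>x. H x * iexp (\<Sum>j\<in>S. c j * X j x) \<partial>M) = 0"
  shows "(\<integral>x. H x * (\<Prod>j\<in>S. indicator (B j) (X j x)) \<partial>M) = 0"
  using S X B H zero
proof (induction S arbitrary: H rule: finite_induct)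
  case empty
  then show ?case by simp
next
  case (insert k S)
  have [measurable]: "X k \<in> borel_measurable M" "B k \<in> sets borel" "H \<in> borel_measurable M"
    using insert.prems by auto
  have XB[measurable]: "X j \<in> borel_measurable M" "B j \<in> sets borel" if "j \<in> S" for j
    using insert.prems that by auto
  define R where "R x = (\<Prod>j\<in>S. indicator (B j) (X j x) :: complex)" for x
  have [measurable]: "R \<in> borel_measurable M"
    unfolding R_def by measurable
  have R1: "norm (R x) \<le> 1" for x
    unfolding R_def prod_norm[symmetric] by (rule prod_le_1) (auto simp: indicator_def)
  have HR: "integrable M (\<lambda>x. H x * R x)"
    by (rule Bochner_Integration.integrable_bound[OF insert.prems(3)])
      (use R1 in \<open>auto simp: norm_mult mult_left_le\<close>)
  \<comment> \<open>The induction hypothesis for the twisted weight; its own hypothesis is the given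
    one with coefficient \<open>d\<close> inserted at \<open>k\<close>, which leaves the sum over
    \<open>S\<close> unchanged.\<close>
  have "(\<integral>x. (H x * iexp (d * X k x)) * R x \<partial>M) = 0" for d
    unfolding R_def
  proof (rule insert.IH)
    show "integrable M (\<lambda>x. H x * iexp (d * X k x))"
      by (rule Bochner_Integration.integrable_bound[OF insert.prems(3)]) (auto simp: norm_mult)
    show "(\<integral>x. H x * iexp (d * X k x) * iexp (\<Sum>j\<in>S. c j * X j x) \<partial>M) = 0" for c
    proof -
      have "(\<Sum>j\<in>S. (c(k := d)) j * X j x) = (\<Sum>j\<in>S. c j * X j x)" for x
        using insert.hyps by (intro sum.cong) auto
      then have "H x * iexp (d * X k x) * iexp (\<Sum>j\<in>S. c j * X j x)
          = H x * iexp (\<Sum>j\<in>insert k S. (c(k := d)) j * X j x)" for x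
        using insert.hyps by (simp add: exp_add distrib_left)
      then show ?thesis using insert.prems(4)[of "c(k := d)"] by (simp only:)
    qed
  qed (use XB in auto)
  \<comment> \<open>Regrouped, this is the transform along \<open>X k\<close> of the weight
    \<open>H x * R x\<close>, so the one-dimensional result supplies the last indicator.\<close>
  then have "(\<integral>x. (H x * R x) * iexp (d * X k x) \<partial>M) = 0" for d
    by (simp add: mult_ac)
  from fourier_zero_imp_integral_indicator_zero[OF HR _ this, of "B k"]
  show ?case using insert.hyps by (simp add: R_def mult_ac)
qed

section \<open>Generated sigma-algebras and the passage from cylinders to all their sets\<close>

lemma space_sigma_gen [simp]: "space (sigma_gen M X D) = space M"
  unfolding sigma_gen_def by (rule space_measure_of) auto

lemma sets_sigma_gen:
  "sets (sigma_gen M X D) =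
    sigma_sets (space M) {X t -` A \<inter> space M | t A. t \<in> D \<and> A \<in> sets borel}"
  unfolding sigma_gen_def by (rule sets_measure_of) auto

lemma measurable_sigma_gen: "t \<in> D \<Longrightarrow> X t \<in> borel_measurable (sigma_gen M X D)"
  by (rule measurableI) (auto simp: sets_sigma_gen intro: sigma_sets.Basic)

lemma subalgebra_sigma_gen:
  assumes "\<And>t. t \<in> D \<Longrightarrow> X t \<in> borel_measurable M"
  shows "subalgebra M (sigma_gen M X D)"
  unfolding subalgebra_def sets_sigma_gen
  using assms by (auto intro!: sets.sigma_sets_subset measurable_sets)

text \<open>Cylinders over Borel rectangles form an intersection-stable generator on which the
  integral vanishes by the rectangle case; Dynkin's lemma does the rest.\<close>

lemma fourier_zero_imp_set_integral_zero:
  fixes H :: "'a \<Rightarrow> complex" and X :: "'i \<Rightarrow> 'a \<Rightarrow> real"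
  assumes S: "finite S" and X: "\<And>j. j \<in> S \<Longrightarrow> X j \<in> borel_measurable M"
    and H: "integrable M H"
    and zero: "\<And>c. (\<integral>x. H x * iexp (\<Sum>j\<in>S. c j * X j x) \<partial>M) = 0"
    and A: "A \<in> sets (sigma_gen M X S)"
  shows "(\<integral>x\<in>A. H x \<partial>M) = 0"
proof -
  define G where "G = {{x \<in> space M. \<forall>j\<in>S. X j x \<in> B j} | B. \<forall>j. B j \<in> sets (borel :: real measure)}"
  have Int: "Int_stable G"
  proof (rule Int_stableI)
    fix a b assume "a \<in> G" "b \<in> G"
    then obtain B C where "a = {x \<in> space M. \<forall>j\<in>S. X j x \<in> B j}" "\<forall>j. B j \<in> sets borel"
        "b = {x \<in> space M. \<forall>j\<in>S. X j x \<in> C j}" "\<forall>j. C j \<in> sets borel"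
      by (auto simp: G_def)
    then show "a \<inter> b \<in> G"
      unfolding G_def by (intro CollectI exI[of _ "\<lambda>j. B j \<inter> C j"]) auto
  qed
  \<comment> \<open>A single preimage is a cylinder whose other sides are the whole line.\<close>
  have "X t -` E \<inter> space M \<in> G" if "t \<in> S" "E \<in> sets borel" for t E
    unfolding G_def using that by (intro CollectI exI[of _ "\<lambda>j. if j = t then E else UNIV"]) auto
  then have "sigma_sets (space M) {X t -` A \<inter> space M | t A. t \<in> S \<and> A \<in> sets borel}
      \<subseteq> sigma_sets (space M) G"
    by (intro sigma_sets_mono) (auto intro: sigma_sets.Basic)
  then have A': "A \<in> sigma_sets (space M) G"
    using A unfolding sets_sigma_gen by (rule subsetD)
  have GM: "G \<subseteq> sets M"
  proof
    fix a assume "a \<in> G"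
    then obtain B where "a = {x \<in> space M. \<forall>j\<in>S. X j x \<in> B j}" "\<forall>j. B j \<in> sets borel"
      by (auto simp: G_def)
    moreover from this have "{x \<in> space M. X j x \<in> B j} \<in> sets M" if "j \<in> S" for j
      using measurable_sets[OF X[OF that], of "B j"] by (simp add: vimage_def Int_def conj_commute)
    ultimately show "a \<in> sets M" using S by (simp add: sets.sets_Collect_finite_All)
  qed
  then have sM: "sigma_sets (space M) G \<subseteq> sets M" by (rule sets.sigma_sets_subset)
  have si: "set_integrable M E H" if "E \<in> sets M" for E
    using H that by (simp add: set_integrable_def integrable_mult_indicator)
  \<comment> \<open>Zero frequency in all coordinates; this settles complements in the Dynkin
    induction.\<close>
  have tot: "(\<integral>x. H x \<partial>M) = 0" using zero[of "\<lambda>_. 0"] by simp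
  have GP: "G \<subseteq> Pow (space M)" by (auto simp: G_def)
  from Int GP A' show ?thesis
  proof (induction rule: sigma_sets_induct_disjoint)
    case (basic a)
    then obtain B where a: "a = {x \<in> space M. \<forall>j\<in>S. X j x \<in> B j}" and B: "\<forall>j. B j \<in> sets borel"
      by (auto simp: G_def)
    have "indicator a x *\<^sub>R H x = H x * (\<Prod>j\<in>S. indicator (B j) (X j x))" if "x \<in> space M" for x
    proof (cases "x \<in> a")
      case True
      then have "(\<Prod>j\<in>S. indicator (B j) (X j x)) = (1::complex)" by (intro prod.neutral) (auto simp: a)
      then show ?thesis using True by simp
    next
      case False
      then have "\<exists>j\<in>S. X j x \<notin> B j" using that by (auto simp: a)
      then have "(\<Prod>j\<in>S. indicator (B j) (X j x)) = (0::complex)" using S by (intro prod_zero) (auto simp: indicator_eq_0_iff)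
      then show ?thesis using False by simp
    qed
    then show ?case
      unfolding set_lebesgue_integral_def
      using fourier_zero_imp_rectangle_zero[OF S X _ H zero, of B] B
      by (simp cong: Bochner_Integration.integral_cong)
  next
    case empty
    then show ?case by (simp add: set_lebesgue_integral_def)
  next
    case (compl a)
    then have a: "a \<in> sets M" using sM by auto
    have "(\<integral>x\<in>space M. H x \<partial>M) = (\<integral>x\<in>(space M - a) \<union> a. H x \<partial>M)"
      using sets.sets_into_space[OF a] by (simp add: Un_absorb2)
    also have "\<dots> = (\<integral>x\<in>space M - a. H x \<partial>M) + (\<integral>x\<in>a. H x \<partial>M)"
      using a by (intro set_integral_Un si) auto
    finally show ?case using compl tot set_integral_space[OF H] by simp
  next
    case (union E)
    have "range E \<subseteq> sets M" using union sM by auto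
    then have "(\<integral>x\<in>(\<Union>i. E i). H x \<partial>M) = (\<Sum>i. \<integral>x\<in>E i. H x \<partial>M)"
      using union(1) by (intro lebesgue_integral_countable_add si) (auto simp: disjoint_family_on_def)
    then show ?case using union by simp
  qed
qed

section \<open>Gaussian variables\<close>

lemma integrable_mult_of_squares:
  fixes f g :: "'a \<Rightarrow> real"
  assumes "f \<in> borel_measurable M" "g \<in> borel_measurable M"
    and "integrable M (\<lambda>x. (f x)\<^sup>2)" "integrable M (\<lambda>x. (g x)\<^sup>2)"
  shows "integrable M (\<lambda>x. f x * g x)"
proof (rule Bochner_Integration.integrable_bound)
  show "integrable M (\<lambda>x. (f x)\<^sup>2 + (g x)\<^sup>2)" using assms by simp
  have "\<bar>a * b\<bar> \<le> a\<^sup>2 + b\<^sup>2" for a b :: real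
    using sum_squares_bound[of "\<bar>a\<bar>" "\<bar>b\<bar>"] abs_ge_zero[of "a * b"]
    unfolding abs_mult mult.assoc power2_abs by linarith
  then show "AE x in M. norm (f x * g x) \<le> norm ((f x)\<^sup>2 + (g x)\<^sup>2)" by simp
qed (use assms in measurable)

context prob_space
begin

lemma gaussian_rv_integrable_square:
  assumes "gaussian_rv M Z"
  shows "integrable M (\<lambda>x. (Z x)\<^sup>2)"
proof -
  have Z[measurable]: "Z \<in> borel_measurable M" using assms by (simp add: gaussian_rv_def)
  from assms consider (normal) \<mu> \<sigma> where "\<sigma> > 0" "distributed M lborel Z (normal_density \<mu> \<sigma>)"
    | (const) c where "AE x in M. Z x = c"
    by (auto simp: gaussian_rv_def)
  then show ?thesis
  proof cases
    case normal
    have *: "integrable M (\<lambda>x. (Z x - \<mu>) ^ k)" for k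
      using distributed_integrable[OF normal(2), of "\<lambda>x. (x - \<mu>) ^ k"]
        integrable_normal_moment[OF normal(1), of \<mu> k] by simp
    \<comment> \<open>The square is expanded about the mean so that only central moments occur;
      writing \<open>^ 1\<close> lets the fact \<open>*\<close> cover the linear term.\<close>
    have "integrable M (\<lambda>x. (Z x - \<mu>)\<^sup>2 + 2 * \<mu> * (Z x - \<mu>) ^ 1 + \<mu>\<^sup>2)"
      by (intro Bochner_Integration.integrable_add integrable_mult_right * integrable_const)
    moreover have "(Z x - \<mu>)\<^sup>2 + 2 * \<mu> * (Z x - \<mu>) ^ 1 + \<mu>\<^sup>2 = (Z x)\<^sup>2" for x
      by (simp add: power2_eq_square algebra_simps)
    ultimately show ?thesis by simp
  next
    case const
    have "integrable M (\<lambda>x. (Z x)\<^sup>2) \<longleftrightarrow> integrable M (\<lambda>x. c\<^sup>2)"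
      by (rule integrable_cong_AE) (use const in auto)
    then show ?thesis by simp
  qed
qed

text \<open>One frequency suffices, since the result is applied to arbitrary linear combinations. In
  the degenerate case the variable is almost surely zero and both sides equal one.\<close>

lemma gaussian_rv_iexp:
  assumes "gaussian_rv M Z" and mean: "expectation Z = 0"
  shows "(\<integral>x. iexp (Z x) \<partial>M) = exp (- expectation (\<lambda>x. (Z x)\<^sup>2) / 2)"
proof -
  have Z[measurable]: "Z \<in> borel_measurable M" using assms by (simp add: gaussian_rv_def)
  from assms consider (normal) \<mu> \<sigma> where "\<sigma> > 0" "distributed M lborel Z (normal_density \<mu> \<sigma>)"
    | (const) c where "AE x in M. Z x = c"
    by (auto simp: gaussian_rv_def)
  then show ?thesis
  proof cases
    case normal
    have "\<mu> = 0" using normal_distributed_expectation[OF normal] mean by simp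
    moreover have "expectation (\<lambda>x. (Z x)\<^sup>2) = \<sigma>\<^sup>2"
      using normal_distributed_variance[OF normal] mean by simp
    moreover have "distributed M lborel (\<lambda>x. (Z x - \<mu>) / \<sigma>) std_normal_density"
      using normal normal_standard_normal_convert by blast
    ultimately have D: "distributed M lborel (\<lambda>x. Z x / \<sigma>) std_normal_density"
      and v: "expectation (\<lambda>x. (Z x)\<^sup>2) = \<sigma>\<^sup>2" by auto
    \<comment> \<open>After standardising, the integral is the standard normal characteristic
      function at \<open>\<sigma>\<close>.\<close>
    have "(\<integral>x. iexp (Z x) \<partial>M) = (\<integral>x. iexp (\<sigma> * (Z x / \<sigma>)) \<partial>M)"
      using normal(1) by simp
    also have "\<dots> = (\<integral>y. iexp (\<sigma> * y) \<partial>distr M lborel (\<lambda>x. Z x / \<sigma>))"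
      by (subst integral_distr) auto
    also have "\<dots> = char std_normal_distribution \<sigma>"
      unfolding char_def distributed_distr_eq_density[OF D] by simp
    finally show ?thesis by (simp add: char_std_normal_distribution v)
  next
    case const
    have "expectation Z = expectation (\<lambda>_. c)" by (rule integral_cong_AE) (use const in auto)
    then have "c = 0" using mean by (simp add: prob_space)
    have "(\<integral>x. iexp (Z x) \<partial>M) = (\<integral>x. 1 \<partial>M)"
      by (rule integral_cong_AE) (use const \<open>c = 0\<close> in auto)
    moreover have "expectation (\<lambda>x. (Z x)\<^sup>2) = expectation (\<lambda>_. 0)"
      by (rule integral_cong_AE) (use const \<open>c = 0\<close> in auto)
    ultimately show ?thesis by (simp add: prob_space)
  qed
qed

text \<open>Fourier uniqueness is used twice. Along the \<open>X j\<close> it shows that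
  \<open>Y\<close> and the event \<open>A\<close> are independent at the level of characteristic
  functions; along \<open>Y\<close> it turns this into equality of the mean of \<open>Y\<close> over
  \<open>A\<close> with \<open>prob A\<close> times its mean, which is zero.\<close>

lemma uncorrelated_gaussian_set_integral_zero:
  fixes X :: "'i \<Rightarrow> 'a \<Rightarrow> real" and Y :: "'a \<Rightarrow> real"
  assumes S: "finite S"
    and gauss: "\<And>s c. gaussian_rv M (\<lambda>x. s * Y x + (\<Sum>j\<in>S. c j * X j x))"
    and meanY: "expectation Y = 0" and meanX: "\<And>j. j \<in> S \<Longrightarrow> expectation (X j) = 0"
    and uncor: "\<And>j. j \<in> S \<Longrightarrow> expectation (\<lambda>x. Y x * X j x) = 0"
    and A: "A \<in> sets (sigma_gen M X S)"
  shows "(\<integral>x\<in>A. Y x \<partial>M) = 0"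
proof -
  have gY: "gaussian_rv M Y" using gauss[of 1 "\<lambda>_. 0"] by simp
  have gX: "gaussian_rv M (X k)" if "k \<in> S" for k
  proof -
    have "(\<Sum>j\<in>S. (if j = k then 1 else 0) * X j x) = X k x" for x
      using S that by (simp add: if_distrib[of "\<lambda>u. u * _"] cong: if_cong)
    then show ?thesis using gauss[of 0 "\<lambda>j. if j = k then 1 else 0"] by simp
  qed
  have [measurable]: "Y \<in> borel_measurable M" using gY by (simp add: gaussian_rv_def)
  have X[measurable]: "X k \<in> borel_measurable M" if "k \<in> S" for k
    using gX[OF that] by (simp add: gaussian_rv_def)
  note Y2 = gaussian_rv_integrable_square[OF gY] and X2 = gaussian_rv_integrable_square[OF gX]
  have iY: "integrable M Y" by (rule square_integrable_imp_integrable[OF _ Y2]) simp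
  have iX: "integrable M (X k)" if "k \<in> S" for k
    by (rule square_integrable_imp_integrable[OF X X2]) (use that in auto)
  have AM[measurable]: "A \<in> sets M"
    using subalgebra_sigma_gen[of S X M] X A by (auto simp: subalgebra_def)
  define V where "V c x = (\<Sum>j\<in>S. c j * X j x)" for c x
  have Vm[measurable]: "V c \<in> borel_measurable M" for c unfolding V_def by measurable
  have gV: "gaussian_rv M (V c)" for c using gauss[of 0 c] by (simp add: V_def[abs_def])
  have iV: "integrable M (V c)" "expectation (V c) = 0" for c
    unfolding V_def using iX by (auto simp: meanX)
  have YV: "expectation (\<lambda>x. Y x * V c x) = 0" for c
  proof -
    have "expectation (\<lambda>x. \<Sum>j\<in>S. c j * (Y x * X j x)) = (\<Sum>j\<in>S. expectation (\<lambda>x. c j * (Y x * X j x)))"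
      by (intro Bochner_Integration.integral_sum integrable_mult_right integrable_mult_of_squares X X2 Y2) auto
    also have "\<dots> = 0" by (simp add: uncor)
    finally show ?thesis by (simp add: V_def sum_distrib_left mult_ac)
  qed
  define v where "v = expectation (\<lambda>x. (Y x)\<^sup>2)"
  have var: "expectation (\<lambda>x. (s * Y x + V c x)\<^sup>2) = s\<^sup>2 * v + expectation (\<lambda>x. (V c x)\<^sup>2)" for s c
  proof -
    have i: "integrable M (\<lambda>x. Y x * V c x)" "integrable M (\<lambda>x. (V c x)\<^sup>2)"
      using Y2 gaussian_rv_integrable_square[OF gV] by (auto intro!: integrable_mult_of_squares)
    have "(s * Y x + V c x)\<^sup>2 = s\<^sup>2 * (Y x)\<^sup>2 + (2 * s * (Y x * V c x) + (V c x)\<^sup>2)" for x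
      by (simp add: power2_eq_square algebra_simps)
    then show ?thesis using i Y2 by (simp add: v_def YV)
  qed
  \<comment> \<open>The variance has no mixed term, so the joint characteristic function is a factor
    in \<open>s\<close> times a factor in \<open>c\<close>.\<close>
  have char: "(\<integral>x. iexp (s * Y x + V c x) \<partial>M) = exp (- (s\<^sup>2 * v + expectation (\<lambda>x. (V c x)\<^sup>2)) / 2)" for s c
    unfolding var[symmetric] using gauss[of s c] iY iV meanY
    by (intro gaussian_rv_iexp) (auto simp: V_def[abs_def])
  have *: "(\<integral>x\<in>A. iexp (s * Y x) \<partial>M) = exp (- s\<^sup>2 * v / 2) * prob A" for s
  proof -
    \<comment> \<open>This is the characteristic function of \<open>Y\<close> at \<open>s\<close>,
      so subtracting it centres the weight.\<close>
    define \<phi> where "\<phi> = complex_of_real (exp (- s\<^sup>2 * v / 2))"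
    have i: "integrable M (\<lambda>x. iexp (s * Y x))" "integrable M (\<lambda>x. iexp (V c x))"
      "integrable M (\<lambda>x. iexp (s * Y x + V c x))" for c
      by (intro integrable_iexp; simp)+
    have "(\<integral>x\<in>A. (iexp (s * Y x) - \<phi>) \<partial>M) = 0"
    proof (rule fourier_zero_imp_set_integral_zero[OF S X _ _ A])
      show "integrable M (\<lambda>x. iexp (s * Y x) - \<phi>)" using i by simp
      fix c :: "'i \<Rightarrow> real"
      have "(\<integral>x. (iexp (s * Y x) - \<phi>) * iexp (V c x) \<partial>M)
          = (\<integral>x. iexp (s * Y x + V c x) - \<phi> * iexp (V c x) \<partial>M)"
        by (simp add: left_diff_distrib exp_add distrib_left)
      also have "\<dots> = (\<integral>x. iexp (s * Y x + V c x) \<partial>M) - \<phi> * (\<integral>x. iexp (V c x) \<partial>M)"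
        using i by (simp del: of_real_add)
      \<comment> \<open>Frequency zero in \<open>Y\<close> gives the transform of \<open>V c\<close>
        alone, and the factorisation cancels the two terms.\<close>
      also have "\<dots> = 0"
        using char[of 0 c] char[of s c] by (simp add: \<phi>_def flip: exp_add of_real_mult)
      finally show "(\<integral>x. (iexp (s * Y x) - \<phi>) * iexp (\<Sum>j\<in>S. c j * X j x) \<partial>M) = 0"
        by (simp only: V_def)
    qed auto
    moreover have "(\<integral>x\<in>A. (iexp (s * Y x) - \<phi>) \<partial>M) = (\<integral>x\<in>A. iexp (s * Y x) \<partial>M) - (\<integral>x\<in>A. \<phi> \<partial>M)"
      using i(1) by (intro set_integral_diff) (auto simp: set_integrable_def intro!: integrable_mult_indicator)
    moreover have "(\<integral>x\<in>A. \<phi> \<partial>M) = prob A *\<^sub>R \<phi>"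
      by (rule set_integral_const) auto
    ultimately show ?thesis by (simp add: \<phi>_def scaleR_conv_of_real mult.commute)
  qed
  \<comment> \<open>The roles are exchanged: the weight is now the centred indicator of
    \<open>A\<close>, and its transform is taken along \<open>Y\<close>.\<close>
  define G where "G x = indicator A x - prob A" for x
  have [measurable]: "G \<in> borel_measurable M" unfolding G_def by measurable
  have iG: "integrable M G" unfolding G_def
    by (intro Bochner_Integration.integrable_diff integrable_const integrable_real_indicator) (auto simp: less_top[symmetric])
  have iAY: "integrable M (\<lambda>x. indicator A x * Y x)" 
    using integrable_mult_indicator[OF AM iY] by simp
  have GY: "integrable M (\<lambda>x. G x * Y x)"
    unfolding G_def left_diff_distrib using iAY iY by simp
  have zero: "(\<integral>x. G x *\<^sub>R iexp (s * Y x) \<partial>M) = 0" for s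
  proof -
    have i: "integrable M (\<lambda>x. iexp (s * Y x))" by (intro integrable_iexp) simp_all
    have "(\<integral>x. G x *\<^sub>R iexp (s * Y x) \<partial>M) = (\<integral>x\<in>A. iexp (s * Y x) \<partial>M) - prob A *\<^sub>R (\<integral>x. iexp (s * Y x) \<partial>M)"
      unfolding G_def scaleR_diff_left set_lebesgue_integral_def
      using i by (subst Bochner_Integration.integral_diff) (auto intro!: integrable_mult_indicator simp del: scaleR_conv_of_real)
    also have "(\<integral>x. iexp (s * Y x) \<partial>M) = exp (- s\<^sup>2 * v / 2)"
      using char[of s "\<lambda>_. 0"] by (simp add: V_def)
    finally show ?thesis unfolding * scaleR_conv_of_real by (simp only: of_real_mult mult.commute diff_self)
  qed
  have "(\<integral>x. G x * Y x \<partial>M) = 0"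
    by (rule fourier_zero_imp_integral_zero_real[where f = "\<lambda>y. y", OF iG _ zero _ GY]) simp_all
  then show ?thesis
    using iAY iY meanY by (simp add: G_def left_diff_distrib set_lebesgue_integral_def)
qed

end

section \<open>Convergence along increasing subalgebras\<close>

lemma square_integrable_cmult:
  "square_integrable M f \<Longrightarrow> square_integrable M (\<lambda>x. c * f x)"
  by (auto simp: square_integrable_def power_mult_distrib)

lemma square_integrable_add:
  assumes "square_integrable M f" "square_integrable M g"
  shows "square_integrable M (\<lambda>x. f x + g x)"
proof -
  have "integrable M (\<lambda>x. (f x)\<^sup>2 + (g x)\<^sup>2 + 2 * (f x * g x))"
    using assms unfolding square_integrable_def
    by (intro Bochner_Integration.integrable_add integrable_mult_right integrable_mult_of_squares) auto
  then show ?thesis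
    using assms by (auto simp: square_integrable_def power2_sum mult.assoc)
qed

lemma square_integrable_diff:
  assumes "square_integrable M f" "square_integrable M g"
  shows "square_integrable M (\<lambda>x. f x - g x)"
  using square_integrable_add[OF assms(1) square_integrable_cmult[OF assms(2), of "-1"]] by simp

text \<open>A substitute for the triangle inequality in squared norms; its factor 2 is the source of
  the tolerances \<open>e/4\<close> below.\<close>

lemma integral_square_add_le:
  assumes f: "square_integrable M f" and g: "square_integrable M g"
  shows "(\<integral>x. (f x + g x)\<^sup>2 \<partial>M) \<le> 2 * (\<integral>x. (f x)\<^sup>2 \<partial>M) + 2 * (\<integral>x. (g x)\<^sup>2 \<partial>M)"
proof -
  have "(a + b)\<^sup>2 \<le> 2 * a\<^sup>2 + 2 * b\<^sup>2" for a b :: real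
    using sum_squares_bound[of a b] by (simp add: power2_sum)
  then have "(\<integral>x. (f x + g x)\<^sup>2 \<partial>M) \<le> (\<integral>x. 2 * (f x)\<^sup>2 + 2 * (g x)\<^sup>2 \<partial>M)"
    using f g square_integrable_add[OF f g]
    by (intro integral_mono) (auto simp: square_integrable_def)
  then show ?thesis using f g by (simp add: square_integrable_def)
qed

text \<open>Membership in the closure of the union of the $L^2$ spaces over the \<open>G N\<close>,
  measured by squared distance. Levels start at 1, as the increasing chain does. Square
  integrability of \<open>f\<close> is carried separately, because a divergent Bochner integral
  would count as 0.\<close>

definition L2_approximable :: "'a measure \<Rightarrow> (nat \<Rightarrow> 'a measure) \<Rightarrow> ('a \<Rightarrow> real) \<Rightarrow> bool" where
  "L2_approximable M G f \<longleftrightarrow>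
    (\<forall>e>0. \<exists>N\<ge>1. \<exists>g \<in> borel_measurable (G N). square_integrable M g \<and> (\<integral>x. (f x - g x)\<^sup>2 \<partial>M) < e)"

lemma increasing_subalgebras_mono:
  assumes "\<And>N::nat. N \<ge> 1 \<Longrightarrow> sets (G N) \<subseteq> sets (G (Suc N))" and "1 \<le> m" "m \<le> n"
  shows "sets (G m) \<subseteq> sets (G n)"
  using assms(3) by (induction rule: dec_induct) (use assms(1,2) in \<open>auto dest: order_trans\<close>)

lemma borel_measurable_increasing_subalgebras:
  fixes g :: "'a \<Rightarrow> real"
  assumes "\<And>N. subalgebra M (G N)"
    and "\<And>N::nat. N \<ge> 1 \<Longrightarrow> sets (G N) \<subseteq> sets (G (Suc N))" and "1 \<le> m" "m \<le> n"
    and "g \<in> borel_measurable (G m)"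
  shows "g \<in> borel_measurable (G n)"
  by (rule measurable_from_subalg[OF _ assms(5)])
    (use assms(1) increasing_subalgebras_mono[of G m n] assms(2-4) in \<open>auto simp: subalgebra_def\<close>)

lemma L2_approximable_limit:
  assumes f: "square_integrable M f"
    and h: "\<And>e. e > 0 \<Longrightarrow> \<exists>h. square_integrable M h \<and> L2_approximable M G h \<and> (\<integral>x. (f x - h x)\<^sup>2 \<partial>M) < e"
  shows "L2_approximable M G f"
  unfolding L2_approximable_def
proof (intro allI impI)
  fix e :: real assume "e > 0"
  with h[of "e/4"] obtain h where h: "square_integrable M h" "L2_approximable M G h"
    "(\<integral>x. (f x - h x)\<^sup>2 \<partial>M) < e/4" by auto
  from h(2) \<open>e > 0\<close> obtain N g where g: "N \<ge> 1" "g \<in> borel_measurable (G N)" "square_integrable M g"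
    "(\<integral>x. (h x - g x)\<^sup>2 \<partial>M) < e/4"
    unfolding L2_approximable_def by (metis zero_less_divide_iff zero_less_numeral)
  have "(\<integral>x. (f x - g x)\<^sup>2 \<partial>M) < e"
    using integral_square_add_le[OF square_integrable_diff[OF f h(1)] square_integrable_diff[OF h(1) g(3)]] h(3) g(4)
    by simp
  then show "\<exists>N\<ge>1. \<exists>g \<in> borel_measurable (G N). square_integrable M g \<and> (\<integral>x. (f x - g x)\<^sup>2 \<partial>M) < e"
    using g by blast
qed

lemma L2_approximable_cmult:
  assumes "L2_approximable M G f"
  shows "L2_approximable M G (\<lambda>x. c * f x)"
  unfolding L2_approximable_def
proof (intro allI impI)
  fix e :: real assume e: "e > 0"
  \<comment> \<open>Adding 1 covers the case \<open>c = 0\<close>.\<close>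
  then have "0 < e / (c\<^sup>2 + 1)" by (simp add: add_nonneg_pos)
  with assms obtain N g where g: "N \<ge> 1" "g \<in> borel_measurable (G N)" "square_integrable M g"
    and l: "(\<integral>x. (f x - g x)\<^sup>2 \<partial>M) < e / (c\<^sup>2 + 1)"
    unfolding L2_approximable_def by blast
  have "(\<integral>x. (c * f x - c * g x)\<^sup>2 \<partial>M) = c\<^sup>2 * (\<integral>x. (f x - g x)\<^sup>2 \<partial>M)"
    by (simp flip: right_diff_distrib add: power_mult_distrib)
  also have "\<dots> \<le> (c\<^sup>2 + 1) * (\<integral>x. (f x - g x)\<^sup>2 \<partial>M)"
    by (intro mult_right_mono) auto
  also have "\<dots> < e"
    using l by (simp add: pos_less_divide_eq add_nonneg_pos mult.commute)
  finally show "\<exists>N\<ge>1. \<exists>g \<in> borel_measurable (G N). square_integrable M g \<and> (\<integral>x. (c * f x - g x)\<^sup>2 \<partial>M) < e"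
    using g by (intro exI[of _ N] conjI bexI[of _ "\<lambda>x. c * g x"] square_integrable_cmult) auto
qed

text \<open>Approximants found at two levels are both measurable at the larger one, because the
  chain increases.\<close>

lemma L2_approximable_add:
  assumes G: "\<And>N. subalgebra M (G N)" "\<And>N. N \<ge> 1 \<Longrightarrow> sets (G N) \<subseteq> sets (G (Suc N))"
    and f: "square_integrable M f" "L2_approximable M G f"
    and h: "square_integrable M h" "L2_approximable M G h"
  shows "L2_approximable M G (\<lambda>x. f x + h x)"
  unfolding L2_approximable_def
proof (intro allI impI)
  fix e :: real assume "e > 0"
  then have e: "e/4 > 0" by simp
  from f(2) e obtain N g where g: "N \<ge> 1" "g \<in> borel_measurable (G N)" "square_integrable M g"
    "(\<integral>x. (f x - g x)\<^sup>2 \<partial>M) < e/4" unfolding L2_approximable_def by blast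
  from h(2) e obtain K k where k: "K \<ge> 1" "k \<in> borel_measurable (G K)" "square_integrable M k"
    "(\<integral>x. (h x - k x)\<^sup>2 \<partial>M) < e/4" unfolding L2_approximable_def by blast
  let ?n = "max N K"
  have m: "g \<in> borel_measurable (G ?n)" "k \<in> borel_measurable (G ?n)"
    using borel_measurable_increasing_subalgebras[of M G, OF G g(1) _ g(2), of ?n]
      borel_measurable_increasing_subalgebras[of M G, OF G k(1) _ k(2), of ?n] by auto
  have "(\<integral>x. (f x + h x - (g x + k x))\<^sup>2 \<partial>M) < e"
    using integral_square_add_le[OF square_integrable_diff[OF f(1) g(3)] square_integrable_diff[OF h(1) k(3)]] k(4) g(4)
    by (simp add: algebra_simps)
  then show "\<exists>N\<ge>1. \<exists>g \<in> borel_measurable (G N). square_integrable M g \<and> (\<integral>x. (f x + h x - g x)\<^sup>2 \<partial>M) < e"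
    using g k m by (intro exI[of _ ?n] conjI bexI[of _ "\<lambda>x. g x + k x"] square_integrable_add) auto
qed

section \<open>Density of finite-level functions in the limit space\<close>

context prob_space
begin

lemma square_integrable_indicator:
  "A \<in> events \<Longrightarrow> square_integrable M (indicator A)"
  by (auto simp: square_integrable_def indicator_def power2_eq_square intro!: integrable_const_bound[of _ 1])

text \<open>The union of the chain is intersection stable, since two sets lie in a common level.
  Hence Dynkin's lemma needs only complements and disjoint unions, which follow from linearity and
  closedness.\<close>

lemma L2_approximable_indicator:
  assumes G: "\<And>N. subalgebra M (G N)" "\<And>N. N \<ge> 1 \<Longrightarrow> sets (G N) \<subseteq> sets (G (Suc N))"
    and A: "A \<in> sigma_sets (space M) (\<Union>N\<in>{1..}. sets (G N))"
  shows "L2_approximable M G (indicator A)"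
proof -
  have GM: "(\<Union>N\<in>{1..}. sets (G N)) \<subseteq> events"
    using G(1) by (auto simp: subalgebra_def)
  have M: "B \<in> events" if "B \<in> sigma_sets (space M) (\<Union>N\<in>{1..}. sets (G N))" for B
    using sets.sigma_sets_subset[OF GM] that by blast
  have "Int_stable (\<Union>N\<in>{1..}. sets (G N))"
  proof (rule Int_stableI)
    fix a b assume "a \<in> (\<Union>N\<in>{1..}. sets (G N))" "b \<in> (\<Union>N\<in>{1..}. sets (G N))"
    then obtain m n where "1 \<le> m" "a \<in> sets (G m)" "1 \<le> n" "b \<in> sets (G n)" by auto
    then have "a \<in> sets (G (max m n))" "b \<in> sets (G (max m n))"
      using increasing_subalgebras_mono[of G m "max m n"] increasing_subalgebras_mono[of G n "max m n"] G(2)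
      by auto
    then show "a \<inter> b \<in> (\<Union>N\<in>{1..}. sets (G N))"
      using \<open>1 \<le> m\<close> by (intro UN_I[of "max m n"]) auto
  qed
  moreover have "(\<Union>N\<in>{1..}. sets (G N)) \<subseteq> Pow (space M)"
    using GM sets.space_closed by blast
  ultimately show ?thesis
    using A
  proof (induction rule: sigma_sets_induct_disjoint)
    case (basic a)
    then obtain N where N: "N \<ge> 1" "a \<in> sets (G N)" by auto
    show ?case
      unfolding L2_approximable_def
      using N M[OF sigma_sets.Basic, OF basic]
      by (intro allI impI exI[of _ N] conjI bexI[of _ "indicator a"] square_integrable_indicator) auto
  next
    case empty
    show ?case
      unfolding L2_approximable_def
      by (intro allI impI exI[of _ 1] conjI bexI[of _ "\<lambda>_. 0"]) (auto simp: square_integrable_def)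
  next
    case (compl a)
    have "L2_approximable M G (\<lambda>_. 1)"
      unfolding L2_approximable_def
      by (intro allI impI exI[of _ 1] conjI bexI[of _ "\<lambda>_. 1"]) (auto simp: square_integrable_def)
    then have "L2_approximable M G (\<lambda>x. 1 + (-1) * indicator a x)"
      using compl M by (intro L2_approximable_add[of M G, OF G] L2_approximable_cmult square_integrable_cmult
          square_integrable_indicator) (auto simp: square_integrable_def)
    \<comment> \<open>The two functions differ outside \<open>space M\<close>, so their integrals
      are compared instead.\<close>
    moreover have "(\<integral>x. (indicator (space M - a) x - g x)\<^sup>2 \<partial>M) = (\<integral>x. (1 + (-1) * indicator a x - g x)\<^sup>2 \<partial>M)"
      for g :: "'a \<Rightarrow> real"
      by (rule Bochner_Integration.integral_cong) (auto simp: indicator_def)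
    ultimately show ?case by (simp add: L2_approximable_def)
  next
    case (union a)
    have ev: "a i \<in> events" for i using M union by auto
    define U where "U n = (\<Union>i<n. a i)" for n
    have U: "U n \<in> events" for n using ev by (auto simp: U_def)
    have apU: "L2_approximable M G (indicator (U n))" for n
    proof (induction n)
      case 0
      show ?case
        unfolding L2_approximable_def
        by (intro allI impI exI[of _ 1] conjI bexI[of _ "\<lambda>_. 0"]) (auto simp: square_integrable_def U_def)
    next
      case (Suc n)
      have "a n \<inter> a i = {}" if "i < n" for i
        using union(1) that by (auto simp: disjoint_family_on_def)
      then have "a n \<inter> U n = {}" by (auto simp: U_def)
      then have "indicator (U (Suc n)) x = (indicator (U n) x + indicator (a n) x :: real)" for x
        by (auto simp: U_def lessThan_Suc indicator_def)
      then show ?case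
        using L2_approximable_add[of M G, OF G square_integrable_indicator[OF U] Suc
            square_integrable_indicator[OF ev] union(3)] by simp
    qed
    show ?case
    proof (rule L2_approximable_limit)
      show "square_integrable M (indicator (\<Union>i. a i))" using ev by (intro square_integrable_indicator) auto
      fix e :: real assume e: "e > 0"
      have "(\<lambda>n. prob (U n)) \<longlonglongrightarrow> prob (\<Union>n. U n)"
        using U by (intro finite_Lim_measure_incseq) (auto simp: U_def incseq_def intro: less_le_trans)
      moreover have UU: "(\<Union>n. U n) = (\<Union>i. a i)" by (auto simp: U_def)
      ultimately have "eventually (\<lambda>n. prob (U n) > prob (\<Union>i. a i) - e) sequentially"
        using e by (intro order_tendstoD) auto
      then obtain n where n: "prob (U n) > prob (\<Union>i. a i) - e"
        by (auto simp: eventually_sequentially)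
      \<comment> \<open>The squared distance of nested indicators is the measure of the difference,
        which continuity from below makes small.\<close>
      have "(\<integral>x. (indicator (\<Union>i. a i) x - indicator (U n) x :: real)\<^sup>2 \<partial>M) = (\<integral>x. indicator ((\<Union>i. a i) - U n) x \<partial>M)"
        by (rule Bochner_Integration.integral_cong) (auto simp: indicator_def U_def)
      also have "\<dots> = prob (\<Union>i. a i) - prob (U n)"
        using ev U finite_measure_Diff[of "\<Union>i. a i" "U n"] by (auto simp: U_def)
      finally show "\<exists>h. square_integrable M h \<and> L2_approximable M G h \<and>
          (\<integral>x. (indicator (\<Union>i. a i) x - h x)\<^sup>2 \<partial>M) < e"
        using n apU U by (intro exI[of _ "indicator (U n)"]) (auto intro!: square_integrable_indicator)
    qed
  qed
qed


text \<open>Induction over nonnegative measurable functions, starting from indicators; signed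
  functions are split into their two parts.\<close>

lemma L2_approximable_measurable:
  assumes G: "\<And>N. subalgebra M (G N)" "\<And>N. N \<ge> 1 \<Longrightarrow> sets (G N) \<subseteq> sets (G (Suc N))"
    and F: "subalgebra M F" "sets F = sigma_sets (space M) (\<Union>N\<in>{1..}. sets (G N))"
    and f: "f \<in> borel_measurable F" "square_integrable M f"
  shows "L2_approximable M G f"
proof -
  have FM: "g \<in> borel_measurable M" if "g \<in> borel_measurable F" for g :: "'a \<Rightarrow> real"
    by (rule measurable_from_subalg[OF F(1) that])
  \<comment> \<open>Square integrability is an implication inside the induction: each building block
    inherits it from the composite function.\<close>
  have nonneg: "square_integrable M u \<longrightarrow> L2_approximable M G u"
    if "u \<in> borel_measurable F" "\<And>x. 0 \<le> u x" for u
    using that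
  proof (induction rule: borel_measurable_induct_real)
    case (set A)
    then show ?case using L2_approximable_indicator[of G, OF G] F(2) by auto
  next
    case (mult u c)
    show ?case
    proof (intro impI)
      assume cu: "square_integrable M (\<lambda>x. c * u x)"
      show "L2_approximable M G (\<lambda>x. c * u x)"
      proof (cases "c = 0")
        \<comment> \<open>For \<open>c = 0\<close> the product says nothing about \<open>u\<close>;
          the zero function is treated as the indicator of the empty set.\<close>
        case True
        have "L2_approximable M G (indicator {})"
          by (rule L2_approximable_indicator[of G, OF G]) (auto intro: sigma_sets.Empty)
        moreover have "indicator {} = (\<lambda>_ :: 'a. 0 :: real)" by (simp add: fun_eq_iff)
        ultimately show ?thesis using True by (simp only: mult_zero_left)
      next
        case False
        then have "square_integrable M u" using square_integrable_cmult[OF cu, of "1/c"] by simp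
        then show ?thesis using mult by (intro L2_approximable_cmult) simp
      qed
    qed
  next
    case (add u v)
    show ?case
    proof (intro impI)
      assume s: "square_integrable M (\<lambda>x. v x + u x)"
      have b: "square_integrable M w" if "w \<in> borel_measurable M" "\<And>x. 0 \<le> w x" "\<And>x. w x \<le> v x + u x" for w
        unfolding square_integrable_def
      proof
        show "integrable M (\<lambda>x. (w x)\<^sup>2)"
          by (rule Bochner_Integration.integrable_bound[of _ "\<lambda>x. (v x + u x)\<^sup>2"])
            (use s that in \<open>auto simp: square_integrable_def intro!: power_mono\<close>)
      qed (use that in auto)
      have "square_integrable M v" "square_integrable M u"
        using add.hyps by (auto intro!: b[of v] b[of u] FM)
      then show "L2_approximable M G (\<lambda>x. v x + u x)"
        using add by (intro L2_approximable_add[of M G, OF G]) auto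
    qed
  next
    case (seq U)
    show ?case
    proof (intro impI)
      assume u: "square_integrable M u"
      have [measurable]: "U i \<in> borel_measurable M" for i by (rule FM[OF seq.hyps(1)])
      have [measurable]: "u \<in> borel_measurable M" using u by (simp add: square_integrable_def)
      have u2: "integrable M (\<lambda>x. (u x)\<^sup>2)" using u by (simp add: square_integrable_def)
      have sp: "space F = space M" using F(1) by (simp add: subalgebra_def)
      have le: "U i x \<le> u x" if "x \<in> space M" for i x
        using seq.hyps(3) seq.hyps(4)[of x] that sp
        by (intro incseq_le) (auto simp: incseq_def le_fun_def)
      have Usq: "square_integrable M (U i)" for i
        unfolding square_integrable_def
      proof
        show "integrable M (\<lambda>x. (U i x)\<^sup>2)"
          by (rule Bochner_Integration.integrable_bound[OF u2])
            (use le seq.hyps(2) in \<open>auto intro!: power_mono AE_I2\<close>)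
      qed simp
      \<comment> \<open>Since \<open>U i\<close> lies between 0 and \<open>u\<close> on
        \<open>space M\<close>, the square of \<open>u\<close> is a dominating function.\<close>
      have "(\<lambda>i. \<integral>x. (u x - U i x)\<^sup>2 \<partial>M) \<longlonglongrightarrow> (\<integral>x. 0 \<partial>M)"
      proof (rule integral_dominated_convergence[OF _ _ u2])
        show "AE x in M. (\<lambda>i. (u x - U i x)\<^sup>2) \<longlonglongrightarrow> 0"
        proof (rule AE_I2)
          fix x assume "x \<in> space M"
          then have "(\<lambda>i. (u x - U i x)\<^sup>2) \<longlonglongrightarrow> (u x - u x)\<^sup>2"
            using seq.hyps(4)[of x] sp by (intro tendsto_intros) auto
          then show "(\<lambda>i. (u x - U i x)\<^sup>2) \<longlonglongrightarrow> 0" by simp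
        qed
        show "AE x in M. norm ((u x - U i x)\<^sup>2) \<le> (u x)\<^sup>2" for i
          using le seq.hyps(2) by (auto intro!: AE_I2 power_mono)
      qed auto
      then have lim: "(\<lambda>i. \<integral>x. (u x - U i x)\<^sup>2 \<partial>M) \<longlonglongrightarrow> 0" by simp
      show "L2_approximable M G u"
      proof (rule L2_approximable_limit[OF u])
        fix e :: real assume "e > 0"
        with lim have "eventually (\<lambda>i. (\<integral>x. (u x - U i x)\<^sup>2 \<partial>M) < e) sequentially"
          by (auto intro: order_tendstoD)
        then obtain i where "(\<integral>x. (u x - U i x)\<^sup>2 \<partial>M) < e"
          by (auto simp: eventually_sequentially)
        then show "\<exists>h. square_integrable M h \<and> L2_approximable M G h \<and> (\<integral>x. (u x - h x)\<^sup>2 \<partial>M) < e"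
          using Usq seq.IH by blast
      qed
    qed
  qed
  have part: "square_integrable M (\<lambda>x. max 0 (g x))" if "square_integrable M g" for g
    unfolding square_integrable_def
  proof
    show "integrable M (\<lambda>x. (max 0 (g x))\<^sup>2)"
      by (rule Bochner_Integration.integrable_bound[of _ "\<lambda>x. (g x)\<^sup>2"])
        (use that in \<open>auto simp: square_integrable_def max_def\<close>)
  qed (use that in \<open>auto simp: square_integrable_def\<close>)
  have P: "square_integrable M (\<lambda>x. max 0 (f x))" by (rule part[OF f(2)])
  have N: "square_integrable M (\<lambda>x. max 0 (- f x))"
    using part[of "\<lambda>x. - f x"] f(2) by (simp add: square_integrable_def)
  have "L2_approximable M G (\<lambda>x. max 0 (f x))" "L2_approximable M G (\<lambda>x. max 0 (- f x))"
    using nonneg[of "\<lambda>x. max 0 (f x)"] nonneg[of "\<lambda>x. max 0 (- f x)"] P N f(1) by auto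
  then have "L2_approximable M G (\<lambda>x. max 0 (f x) + (-1) * max 0 (- f x))"
    using P N by (intro L2_approximable_add[of M G, OF G] L2_approximable_cmult square_integrable_cmult)
  moreover have "max 0 (f x) + (-1) * max 0 (- f x) = f x" for x by (simp add: max_def)
  ultimately show ?thesis by simp
qed

section \<open>Conditional expectations in $L^2$\<close>

lemma real_cond_exp_L2_contraction:
  assumes F: "subalgebra M F" and f: "square_integrable M f"
  shows "square_integrable M (real_cond_exp M F f)"
    and "(\<integral>x. (real_cond_exp M F f x)\<^sup>2 \<partial>M) \<le> (\<integral>x. (f x)\<^sup>2 \<partial>M)"
proof -
  interpret F: finite_measure_subalgebra M F by unfold_locales (rule F)
  have [measurable]: "f \<in> borel_measurable M" and f2: "integrable M (\<lambda>x. (f x)\<^sup>2)"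
    using f by (auto simp: square_integrable_def)
  have f1: "integrable M f" by (rule square_integrable_imp_integrable[OF _ f2]) simp
  \<comment> \<open>Jensen's inequality for the square; the blanks are its conditions on the
    interval of values.\<close>
  note jensen = f1 _ _ f2 convex_power2
  have i: "integrable M (\<lambda>x. (real_cond_exp M F f x)\<^sup>2)"
    by (rule F.integrable_convex_cond_exp[OF jensen]) auto
  then show "square_integrable M (real_cond_exp M F f)" by (simp add: square_integrable_def)
  have "AE x in M. (real_cond_exp M F f x)\<^sup>2 \<le> real_cond_exp M F (\<lambda>x. (f x)\<^sup>2) x"
    by (rule F.real_cond_exp_jensens_inequality(2)[OF jensen]) auto
  then have "(\<integral>x. (real_cond_exp M F f x)\<^sup>2 \<partial>M) \<le> (\<integral>x. real_cond_exp M F (\<lambda>x. (f x)\<^sup>2) x \<partial>M)"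
    using i F.real_cond_exp_int(1)[OF f2] by (intro integral_mono_AE)
  then show "(\<integral>x. (real_cond_exp M F f x)\<^sup>2 \<partial>M) \<le> (\<integral>x. (f x)\<^sup>2 \<partial>M)"
    using F.real_cond_exp_int(2)[OF f2] by simp
qed

text \<open>Let \<open>g\<close> be a finite-level approximant of the limit \<open>Z\<close>. From
  its level on, the tower property and \<open>g\<close> being fixed by conditioning show that the
  error is the conditional expectation of \<open>Z - g\<close> minus \<open>Z - g\<close>. By
  contraction its squared norm is at most four times that of \<open>Z - g\<close>.\<close>

lemma real_cond_exp_increasing_L2_tendsto:
  assumes G: "\<And>N. subalgebra M (G N)" and F: "subalgebra M F"
    and inc: "sigma_increases_to G F" and X: "square_integrable M X"
  shows "L2_tendsto M (\<lambda>N. real_cond_exp M (G N) X) (real_cond_exp M F X)"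
proof -
  have mono: "sets (G N) \<subseteq> sets (G (Suc N))" if "N \<ge> 1" for N
    using inc that by (simp add: sigma_increases_to_def)
  have FG: "sets F = sigma_sets (space M) (\<Union>N\<in>{1..}. sets (G N))"
    using inc F by (simp add: sigma_increases_to_def subalgebra_def)
  interpret F: finite_measure_subalgebra M F by unfold_locales (rule F)
  define Z where "Z = real_cond_exp M F X"
  have Z: "square_integrable M Z" unfolding Z_def by (rule real_cond_exp_L2_contraction[OF F X])
  have intg: "integrable M f" if "square_integrable M f" for f
    using that by (auto simp: square_integrable_def intro: square_integrable_imp_integrable)
  have ap: "L2_approximable M G Z"
    by (rule L2_approximable_measurable[of G, OF G mono F FG _ Z]) (auto simp: Z_def)
  have "(\<lambda>n. \<integral>x. (real_cond_exp M (G n) X x - Z x)\<^sup>2 \<partial>M) \<longlonglongrightarrow> 0"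
  proof (rule LIMSEQ_I)
    fix e :: real assume "e > 0"
    then obtain K g where K: "K \<ge> 1" "g \<in> borel_measurable (G K)" and g: "square_integrable M g"
      and lt: "(\<integral>x. (Z x - g x)\<^sup>2 \<partial>M) < e/4"
      using ap unfolding L2_approximable_def by (metis zero_less_divide_iff zero_less_numeral)
    have "norm ((\<integral>x. (real_cond_exp M (G n) X x - Z x)\<^sup>2 \<partial>M) - 0) < e" if "n \<ge> K" for n
    proof -
      interpret Gn: finite_measure_subalgebra M "G n" by unfold_locales (rule G)
      have gn: "g \<in> borel_measurable (G n)"
        by (rule borel_measurable_increasing_subalgebras[of M G, OF G mono K(1) that K(2)])
      have "subalgebra F (G n)"
        unfolding subalgebra_def FG using G F K(1) that
        by (auto simp: subalgebra_def intro!: sigma_sets.Basic bexI[of _ n])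
      then have "AE x in M. real_cond_exp M (G n) Z x = real_cond_exp M (G n) X x"
        unfolding Z_def by (intro Gn.real_cond_exp_nested_subalg F intg X)
      moreover have "AE x in M. real_cond_exp M (G n) (\<lambda>x. Z x - g x) x =
          real_cond_exp M (G n) Z x - real_cond_exp M (G n) g x"
        by (intro Gn.real_cond_exp_diff intg Z g)
      moreover have "AE x in M. real_cond_exp M (G n) g x = g x"
        by (intro Gn.real_cond_exp_F_meas intg g gn)
      ultimately have "AE x in M. (real_cond_exp M (G n) X x - Z x)\<^sup>2 =
          (real_cond_exp M (G n) (\<lambda>x. Z x - g x) x + (-1) * (Z x - g x))\<^sup>2"
        by eventually_elim simp
      then have "(\<integral>x. (real_cond_exp M (G n) X x - Z x)\<^sup>2 \<partial>M) =
          (\<integral>x. (real_cond_exp M (G n) (\<lambda>x. Z x - g x) x + (-1) * (Z x - g x))\<^sup>2 \<partial>M)"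
        using Z g by (intro integral_cong_AE) (auto simp: square_integrable_def)
      also have "\<dots> \<le> 2 * (\<integral>x. (real_cond_exp M (G n) (\<lambda>x. Z x - g x) x)\<^sup>2 \<partial>M)
          + 2 * (\<integral>x. ((-1) * (Z x - g x))\<^sup>2 \<partial>M)"
        by (intro integral_square_add_le real_cond_exp_L2_contraction G square_integrable_cmult
            square_integrable_diff Z g)
      also have "\<dots> \<le> 4 * (\<integral>x. (Z x - g x)\<^sup>2 \<partial>M)"
        using real_cond_exp_L2_contraction(2)[OF G square_integrable_diff[OF Z g], of n]
        by (simp add: power2_commute[of "g _"])
      also have "\<dots> < e" using lt by simp
      finally show ?thesis by simp
    qed
    then show "\<exists>K. \<forall>n\<ge>K. norm ((\<integral>x. (real_cond_exp M (G n) X x - Z x)\<^sup>2 \<partial>M) - 0) < e" by blast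
  qed
  then show ?thesis
    using Z real_cond_exp_L2_contraction(1)[OF G X] by (simp add: L2_tendsto_def Z_def)
qed

section \<open>Regression on finitely many Gaussian observations\<close>

text \<open>Orthogonality of the residual to the observations makes its integral vanish over every
  set they generate; as the linear predictor is measurable there, it satisfies the defining property
  of the conditional expectation.\<close>

lemma gaussian_real_cond_exp_eq_linear:
  fixes X :: "'i \<Rightarrow> 'a \<Rightarrow> real"
  assumes gauss: "gaussian_process M I X" and cent: "centered_process M I X"
    and S: "finite S" "S \<subseteq> I" and t: "t \<in> I" "t \<notin> S"
    and orth: "\<And>u. u \<in> S \<Longrightarrow> expectation (\<lambda>x. (X t x - (\<Sum>v\<in>S. d v * X v x)) * X u x) = 0"
  shows "AE x in M. real_cond_exp M (sigma_gen M X S) (X t) x = (\<Sum>v\<in>S. d v * X v x)"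
proof -
  have int: "integrable M (X u)" and mean: "expectation (X u) = 0" if "u \<in> I" for u
    using cent that by (auto simp: centered_process_def)
  have meas: "X u \<in> borel_measurable M" if "u \<in> I" for u using int[OF that] by simp
  have sub: "subalgebra M (sigma_gen M X S)"
    using meas S by (intro subalgebra_sigma_gen) auto
  interpret F: finite_measure_subalgebra M "sigma_gen M X S" by unfold_locales (rule sub)
  let ?L = "\<lambda>x. \<Sum>v\<in>S. d v * X v x"
  have iL: "integrable M ?L"
    by (intro Bochner_Integration.integrable_sum integrable_mult_right int) (use S in auto)
  have "(\<integral>x\<in>A. (X t x - ?L x) \<partial>M) = 0" if A: "A \<in> sets (sigma_gen M X S)" for A
  proof (rule uncorrelated_gaussian_set_integral_zero[OF S(1) _ _ _ orth A])
    fix s and c :: "'i \<Rightarrow> real"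
    \<comment> \<open>Expanding the residual gives coefficient \<open>s\<close> at \<open>t\<close>
      and subtracts \<open>s * d v\<close> at each observation; \<open>t \<notin> S\<close> keeps
      the two kinds apart.\<close>
    let ?e = "\<lambda>v. if v = t then s else c v - s * d v"
    have "gaussian_rv M (\<lambda>x. \<Sum>v\<in>insert t S. ?e v * X v x)"
      by (rule gauss[unfolded gaussian_process_def, rule_format]) (use S t in auto)
    moreover have "(\<Sum>v\<in>insert t S. ?e v * X v x) = s * (X t x - ?L x) + (\<Sum>v\<in>S. c v * X v x)" for x
    proof -
      have "(\<Sum>v\<in>S. ?e v * X v x) = (\<Sum>v\<in>S. c v * X v x - s * (d v * X v x))"
        using t by (intro sum.cong) (auto simp: algebra_simps)
      then show ?thesis using S t by (simp add: sum_subtractf sum_distrib_left algebra_simps)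
    qed
    ultimately show "gaussian_rv M (\<lambda>x. s * (X t x - ?L x) + (\<Sum>v\<in>S. c v * X v x))" by simp
  next
    have "expectation ?L = (\<Sum>v\<in>S. expectation (\<lambda>x. d v * X v x))"
      using int S by (intro Bochner_Integration.integral_sum) auto
    also have "\<dots> = 0" using mean S by (intro sum.neutral) auto
    finally show "expectation (\<lambda>x. X t x - ?L x) = 0" using int iL mean t by simp
  qed (use mean S in auto)
  note zero = this
  have "(\<integral>x\<in>A. X t x \<partial>M) = (\<integral>x\<in>A. ?L x \<partial>M)" if A: "A \<in> sets (sigma_gen M X S)" for A
  proof -
    have "A \<in> events" using A sub by (auto simp: subalgebra_def)
    then have "set_integrable M A (X t)" "set_integrable M A ?L"
      using int[OF t(1)] iL by (auto simp: set_integrable_def simp del: real_scaleR_def intro!: integrable_mult_indicator)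
    then show ?thesis using zero[OF A] by (simp add: set_integral_diff)
  qed
  then show ?thesis
    by (rule F.real_cond_exp_charact)
      (use int t iL in \<open>auto intro!: borel_measurable_sum borel_measurable_times measurable_sigma_gen\<close>)
qed

end

text \<open>Full rank makes the determinant nonzero, so \<open>mat_inverse\<close> returns a genuine
  inverse and \<open>the\<close> is harmless; the claim is row \<open>k\<close> of the resulting
  matrix equation.\<close>

lemma pred_coeffs_normal_equations:
  assumes rank: "vec_space.rank N (cov_mat M X N p) = N" and k: "k < N"
  shows "(\<Sum>j<N. (\<integral>\<omega>. X (p k) \<omega> * X (p j) \<omega> \<partial>M) * vec_index (pred_coeffs M X N p t) j)
    = (\<integral>\<omega>. X t \<omega> * X (p k) \<omega> \<partial>M)"
proof -
  let ?R = "cov_mat M X N p" and ?b = "cov_vec M X N p t"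
  have R: "?R \<in> carrier_mat N N" and b: "?b \<in> carrier_vec N"
    by (auto simp: cov_mat_def cov_vec_def)
  have "det ?R \<noteq> 0" using vec_space.det_rank_iff[OF R] rank by simp
  then have "?R \<in> Units (ring_mat TYPE(real) N ())" by (rule det_non_zero_imp_unit[OF R])
  then obtain B where B: "mat_inverse ?R = Some B"
    using mat_inverse(1)[OF R, where b = "()"] by (cases "mat_inverse ?R") auto
  have RB: "?R * B = 1\<^sub>m N" "B \<in> carrier_mat N N" using mat_inverse(2)[OF R B] by auto
  have "?R *\<^sub>v pred_coeffs M X N p t = (?R * B) *\<^sub>v ?b"
    using R RB(2) b by (simp add: pred_coeffs_def B)
  also have "\<dots> = ?b" using RB(1) b by simp
  finally have "vec_index (?R *\<^sub>v pred_coeffs M X N p t) k = vec_index ?b k" by simp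
  moreover have "dim_vec (pred_coeffs M X N p t) = N"
    using RB(2) by (simp add: pred_coeffs_def B)
  ultimately show ?thesis
    using k by (simp add: cov_mat_def cov_vec_def scalar_prod_def atLeast0LessThan)
qed

text \<open>Only the outermost endpoints are bounded directly. The ordering carries the bound 0
  upward through the lower ends and the bound \<open>T\<close> downward through the upper
  ends.\<close>

lemma interval_union_subset:
  assumes "interval_union T \<Delta>"
  shows "\<Delta> \<subseteq> {0..T}"
proof -
  obtain n :: nat and tL tU where 0: "0 \<le> tL 1" and T: "tU n \<le> T"
    and LU: "\<And>i. i \<in> {1..n} \<Longrightarrow> tL i < tU i"
    and UL: "\<And>i. i \<in> {1..<n} \<Longrightarrow> tU i < tL (Suc i)"
    and \<Delta>: "\<Delta> = (\<Union>i\<in>{1..n}. {tL i..tU i})"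
    using assms by (auto simp: interval_union_def)
  have "0 \<le> tL i" if "1 \<le> i" "i \<le> n" for i
    using that
  proof (induction i rule: dec_induct)
    case base
    then show ?case using 0 by simp
  next
    case (step i)
    then show ?case using LU[of i] UL[of i] by auto
  qed
  moreover have "tU i \<le> T" if "i \<le> n" "1 \<le> i" for i
    using that
  proof (induction i rule: inc_induct)
    case base
    then show ?case using T by simp
  next
    case (step i)
    then show ?case using LU[of "Suc i"] UL[of i] by auto
  qed
  ultimately show ?thesis unfolding \<Delta> by fastforce
qed

text \<open>The points \<open>q N\<close> may change altogether with \<open>N\<close>; it is the
  generated sigma-algebras that must increase.\<close>

theorem theorem2p4:
  fixes M :: "'a measure" and X :: "real \<Rightarrow> 'a \<Rightarrow> real" and T :: real and \<Delta> :: "real set"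
  assumes "standing_assumption M T X"
    and "interval_union T \<Delta>"
  shows "(\<forall>N\<ge>1. \<forall>p. full_rank_points M X \<Delta> N p \<longrightarrow>
           (\<forall>t \<in> {0..T} - p ` {..<N}.
              AE \<omega> in M. real_cond_exp M (sigma_gen M X (p ` {..<N})) (X t) \<omega> =
                (\<Sum>j<N. vec_index (pred_coeffs M X N p t) j * X (p j) \<omega>))) \<and>
         (\<forall>q :: nat \<Rightarrow> nat \<Rightarrow> real.
           (\<forall>N\<ge>1. full_rank_points M X \<Delta> N (q N)) \<and>
           sigma_increases_to (\<lambda>N. sigma_gen M X (q N ` {..<N})) (sigma_gen M X \<Delta>) \<longrightarrow>
           (\<forall>t \<in> {0..T}.
              L2_tendsto M (\<lambda>N. real_cond_exp M (sigma_gen M X (q N ` {..<N})) (X t))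
                (real_cond_exp M (sigma_gen M X \<Delta>) (X t))))"
proof -
  from assms(1) interpret prob_space M by (simp add: standing_assumption_def)
  have gauss: "gaussian_process M {0..T} X" and cent: "centered_process M {0..T} X"
    using assms(1) by (auto simp: standing_assumption_def)
  have \<Delta>: "\<Delta> \<subseteq> {0..T}" by (rule interval_union_subset[OF assms(2)])
  have rv: "gaussian_rv M (X u)" if "u \<in> {0..T}" for u
    using gauss[unfolded gaussian_process_def, rule_format, of "{u}" "\<lambda>_. 1"] that by simp
  have meas: "X u \<in> borel_measurable M" if "u \<in> {0..T}" for u
    using rv[OF that] by (simp add: gaussian_rv_def)
  have sq: "integrable M (\<lambda>x. (X u x)\<^sup>2)" if "u \<in> {0..T}" for u
    by (rule gaussian_rv_integrable_square[OF rv[OF that]])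
  have prod: "integrable M (\<lambda>x. X u x * X v x)" if "u \<in> {0..T}" "v \<in> {0..T}" for u v
    using that by (intro integrable_mult_of_squares meas sq)
  have sub: "subalgebra M (sigma_gen M X D)" if "D \<subseteq> {0..T}" for D
    using meas that by (intro subalgebra_sigma_gen) auto
  show ?thesis
  proof (intro conjI allI impI ballI)
    fix N :: nat and p t
    assume full: "full_rank_points M X \<Delta> N p" and t: "t \<in> {0..T} - p ` {..<N}"
    have inj: "inj_on p {..<N}" and p: "p ` {..<N} \<subseteq> {0..T}"
      and rank: "vec_space.rank N (cov_mat M X N p) = N"
      using full \<Delta> by (auto simp: full_rank_points_def)
    let ?a = "\<lambda>j. vec_index (pred_coeffs M X N p t) j"
    \<comment> \<open>The regression lemma indexes coefficients by points, the matrices by position;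
      injectivity of \<open>p\<close> makes the translation possible.\<close>
    define d where "d v = ?a (the_inv_into {..<N} p v)" for v
    have lin: "(\<Sum>v\<in>p ` {..<N}. d v * f v) = (\<Sum>j<N. ?a j * f (p j))" for f
      using inj by (simp add: sum.reindex d_def the_inv_into_f_f)
    have "AE x in M. real_cond_exp M (sigma_gen M X (p ` {..<N})) (X t) x = (\<Sum>v\<in>p ` {..<N}. d v * X v x)"
    proof (rule gaussian_real_cond_exp_eq_linear[OF gauss cent _ p])
      fix u assume "u \<in> p ` {..<N}"
      then obtain k where k: "k < N" "u = p k" by auto
      have pj: "p j \<in> {0..T}" if "j < N" for j using p that by auto
      have "expectation (\<lambda>x. (X t x - (\<Sum>v\<in>p ` {..<N}. d v * X v x)) * X u x)
          = expectation (\<lambda>x. X t x * X u x - (\<Sum>j<N. ?a j * (X u x * X (p j) x)))"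
        unfolding lin by (simp add: left_diff_distrib right_diff_distrib sum_distrib_left sum_distrib_right mult_ac)
      also have "\<dots> = expectation (\<lambda>x. X t x * X u x) - (\<Sum>j<N. expectation (\<lambda>x. X u x * X (p j) x) * ?a j)"
        using t k pj prod by (subst Bochner_Integration.integral_diff) (auto simp: mult.commute)
      \<comment> \<open>Row \<open>k\<close> of the normal equations.\<close>
      also have "\<dots> = 0"
        using pred_coeffs_normal_equations[OF rank k(1), of t] k(2) by simp
      finally show "expectation (\<lambda>x. (X t x - (\<Sum>v\<in>p ` {..<N}. d v * X v x)) * X u x) = 0" .
    qed (use t in auto)
    then show "AE \<omega> in M. real_cond_exp M (sigma_gen M X (p ` {..<N})) (X t) \<omega> = (\<Sum>j<N. ?a j * X (p j) \<omega>)"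
      unfolding lin .
  next
    fix q :: "nat \<Rightarrow> nat \<Rightarrow> real" and t
    assume q: "(\<forall>N\<ge>1. full_rank_points M X \<Delta> N (q N)) \<and>
        sigma_increases_to (\<lambda>N. sigma_gen M X (q N ` {..<N})) (sigma_gen M X \<Delta>)" and t: "t \<in> {0..T}"
    have "q N ` {..<N} \<subseteq> {0..T}" for N
    \<comment> \<open>Full rank is assumed from \<open>N = 1\<close> on, while the convergence lemma
      wants a subalgebra at every level; at level 0 the point set is empty.\<close>
    proof (cases "N = 0")
      case False
      then have "full_rank_points M X \<Delta> N (q N)" using q by simp
      then show ?thesis using \<Delta> by (auto simp: full_rank_points_def)
    qed simp
    then show "L2_tendsto M (\<lambda>N. real_cond_exp M (sigma_gen M X (q N ` {..<N})) (X t))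
        (real_cond_exp M (sigma_gen M X \<Delta>) (X t))"
      using q \<Delta> meas[OF t] sq[OF t]
      by (intro real_cond_exp_increasing_L2_tendsto sub) (auto simp: square_integrable_def)
  qed
qed

end
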